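(* Let $(F_i)_{i=1}^\infty$ be a sequence of sets in a Banach space $X$. Then the following conditions are equivalent: (1) (Admissibility) The sequence $(F_i)$ is admissible for testing compactness, i.e. $$\limsup_{i\to\infty}\ \sup_{f_i\in F_i}\|Tf_i\|_Y=0$$ for every Banach space $Y$ and every compact linear operator $T:X\to Y$. (2) (Weakly null) For every $f^*\in X^*$ and for every subsequence $f_{i(k)}\in F_{i(k)}$ we have $$\lim_{k\to\infty}\langle f_{i(k)},f^*\rangle=0.$$
   Context: $X^*$ is the continuous dual of $X$, and $\langle x,f^*\rangle:=f^*(x)$. The Banach spaces $Y$ are over the same scalar field as $X$. A "subsequence $f_{i(k)}\in F_{i(k)}$" means a choice of strictly increasing indices $i(1)<i(2)<\cdots$ together with a choice of an element $f_{i(k)}\in F_{i(k)}$ for each $k=1,2,\ldots$. The supremum of nonnegative quantities over an empty set is $0$. *)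

theory Defs
  imports "HOL-Analysis.Analysis" "HOL-Algebra.Module"
begin

text \<open>
  Normed spaces are carrier-based records, since the Banach space \<open>Y\<close> is quantified inside a
  formula. The scalars are a type \<open>'k\<close> of sort
  \<open>{real_normed_field, euclidean_space}\<close>; both \<open>real\<close> and \<open>complex\<close> are instances, and up to
  isomorphism there are no others (finite-dimensional field extensions of the reals).
\<close>

definition scalar_ring :: "'k::real_normed_field ring" where
  "scalar_ring = \<lparr>carrier = UNIV, mult = (*), one = 1, zero = 0, add = (+)\<rparr>"

text \<open>
  The fields \<open>mult\<close> and \<open>one\<close> inherited from the ring record are unused, as in every
  \<open>module\<close> record of HOL-Algebra.
\<close>

record ('k, 'v) normed_space = "('k, 'v) module" +
  vnorm :: "'v \<Rightarrow> real"

definition normed_space :: "('k::real_normed_field, 'v) normed_space \<Rightarrow> bool" where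
  "normed_space X \<longleftrightarrow>
     Module.module scalar_ring X \<and>
     (\<forall>x\<in>carrier X. vnorm X x = 0 \<longleftrightarrow> x = \<zero>\<^bsub>X\<^esub>) \<and>
     (\<forall>c. \<forall>x\<in>carrier X. vnorm X (c \<odot>\<^bsub>X\<^esub> x) = norm c * vnorm X x) \<and>
     (\<forall>x\<in>carrier X. \<forall>y\<in>carrier X. vnorm X (x \<oplus>\<^bsub>X\<^esub> y) \<le> vnorm X x + vnorm X y)"

text \<open>
  A \<open>Metric_space\<close> distance has to be nonnegative and symmetric on the whole type, hence the
  value 0 off the carrier.
\<close>

definition norm_dist :: "('k, 'v) normed_space \<Rightarrow> 'v \<Rightarrow> 'v \<Rightarrow> real" where
  "norm_dist X x y =
     (if x \<in> carrier X \<and> y \<in> carrier X then vnorm X (x \<ominus>\<^bsub>X\<^esub> y) else 0)"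

abbreviation norm_metric :: "('k, 'v) normed_space \<Rightarrow> 'v metric" where
  "norm_metric X \<equiv> metric (carrier X, norm_dist X)"

abbreviation norm_topology :: "('k, 'v) normed_space \<Rightarrow> 'v topology" where
  "norm_topology X \<equiv> mtopology_of (norm_metric X)"

lemma Metric_space_norm_dist:
  fixes X :: "('k::real_normed_field, 'v) normed_space"
  assumes "normed_space X"
  shows "Metric_space (carrier X) (norm_dist X)"
proof -
  interpret Module.module scalar_ring X
    using assms by (simp add: normed_space_def)
  have zero: "vnorm X x = 0 \<longleftrightarrow> x = \<zero>\<^bsub>X\<^esub>" if "x \<in> carrier X" for x
    using assms that by (simp add: normed_space_def)
  have scale: "vnorm X (c \<odot>\<^bsub>X\<^esub> x) = norm c * vnorm X x" if "x \<in> carrier X" for c x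
    using assms that by (simp add: normed_space_def)
  have tri: "vnorm X (x \<oplus>\<^bsub>X\<^esub> y) \<le> vnorm X x + vnorm X y"
    if "x \<in> carrier X" "y \<in> carrier X" for x y
    using assms that by (simp add: normed_space_def)
  have "\<ominus>\<^bsub>scalar_ring\<^esub> \<one>\<^bsub>scalar_ring\<^esub> = (- 1 :: 'k)"
    by (rule R.minus_equality) (auto simp: scalar_ring_def)
  then have neg: "vnorm X (\<ominus>\<^bsub>X\<^esub> x) = vnorm X x" if "x \<in> carrier X" for x
    using scale[OF that, of "- 1"] smult_l_minus[of "\<one>\<^bsub>scalar_ring\<^esub>" x] smult_one[OF that] that
    by (simp add: scalar_ring_def)
  have nonneg: "0 \<le> vnorm X x" if "x \<in> carrier X" for x
    using tri[of x "\<ominus>\<^bsub>X\<^esub> x"] neg[OF that] zero[of "\<zero>\<^bsub>X\<^esub>"] that by (simp add: M.r_neg)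
  show ?thesis
  proof
    show "0 \<le> norm_dist X x y" for x y
      by (simp add: norm_dist_def nonneg)
    show "norm_dist X x y = norm_dist X y x" for x y
    proof (cases "x \<in> carrier X \<and> y \<in> carrier X")
      case True
      then have "\<ominus>\<^bsub>X\<^esub> (x \<ominus>\<^bsub>X\<^esub> y) = y \<ominus>\<^bsub>X\<^esub> x"
        by (simp add: a_minus_def M.minus_add M.a_comm)
      then show ?thesis
        using neg[of "x \<ominus>\<^bsub>X\<^esub> y"] True by (simp add: norm_dist_def)
    qed (auto simp: norm_dist_def)
    show "norm_dist X x y = 0 \<longleftrightarrow> x = y" if "x \<in> carrier X" "y \<in> carrier X" for x y
    proof -
      have "(x \<ominus>\<^bsub>X\<^esub> y) \<oplus>\<^bsub>X\<^esub> y = x"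
        using that by (simp add: a_minus_def M.a_assoc M.l_neg)
      then have "x \<ominus>\<^bsub>X\<^esub> y = \<zero>\<^bsub>X\<^esub> \<longleftrightarrow> x = y"
        using that by (auto simp: a_minus_def M.r_neg)
      then show ?thesis
        using that by (simp add: norm_dist_def zero)
    qed
    show "norm_dist X x z \<le> norm_dist X x y + norm_dist X y z"
      if "x \<in> carrier X" "y \<in> carrier X" "z \<in> carrier X" for x y z
    proof -
      have "(x \<ominus>\<^bsub>X\<^esub> y) \<oplus>\<^bsub>X\<^esub> (y \<ominus>\<^bsub>X\<^esub> z) = x \<ominus>\<^bsub>X\<^esub> z"
        using that by (simp add: a_minus_def M.a_assoc M.r_neg1)
      then show ?thesis
        using tri[of "x \<ominus>\<^bsub>X\<^esub> y" "y \<ominus>\<^bsub>X\<^esub> z"] that by (simp add: norm_dist_def)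
    qed
  qed
qed

definition banach_space :: "('k::real_normed_field, 'v) normed_space \<Rightarrow> bool" where
  "banach_space X \<longleftrightarrow> normed_space X \<and> mcomplete_of (norm_metric X)"

definition linear_operator ::
    "('k, 'v) normed_space \<Rightarrow> ('k, 'w) normed_space \<Rightarrow> ('v \<Rightarrow> 'w) \<Rightarrow> bool" where
  "linear_operator X Y T \<longleftrightarrow>
     T \<in> carrier X \<rightarrow> carrier Y \<and>
     (\<forall>x\<in>carrier X. \<forall>y\<in>carrier X. T (x \<oplus>\<^bsub>X\<^esub> y) = T x \<oplus>\<^bsub>Y\<^esub> T y) \<and>
     (\<forall>c. \<forall>x\<in>carrier X. T (c \<odot>\<^bsub>X\<^esub> x) = c \<odot>\<^bsub>Y\<^esub> T x)"

definition compact_operator ::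
    "('k, 'v) normed_space \<Rightarrow> ('k, 'w) normed_space \<Rightarrow> ('v \<Rightarrow> 'w) \<Rightarrow> bool" where
  "compact_operator X Y T \<longleftrightarrow>
     linear_operator X Y T \<and>
     (\<forall>B \<subseteq> carrier X. (\<exists>C. \<forall>x\<in>B. vnorm X x \<le> C) \<longrightarrow>
        compactin (norm_topology Y) (norm_topology Y closure_of (T ` B)))"

definition scalar_space :: "('k::real_normed_field, 'k) normed_space" where
  "scalar_space = \<lparr>carrier = UNIV, mult = (*), one = 1, zero = 0, add = (+), smult = (*), vnorm = norm\<rparr>"

definition dual :: "('k::real_normed_field, 'v) normed_space \<Rightarrow> ('v \<Rightarrow> 'k) set" where
  "dual X = {\<phi>. linear_operator X scalar_space \<phi> \<and> continuous_map (norm_topology X) euclidean \<phi>}"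

text \<open>
  Agreement with the type class \<open>banach\<close>; \<open>m\<close> and \<open>e\<close> fill the unused
  fields.
\<close>

lemma banach_space_UNIV:
  fixes s :: "'k::real_normed_field \<Rightarrow> 'v::banach \<Rightarrow> 'v"
  assumes "vector_space s" and "\<And>c x. norm (s c x) = norm c * norm x"
  shows "banach_space \<lparr>carrier = UNIV, mult = m, one = e, zero = 0, add = (+), smult = s, vnorm = norm\<rparr>"
    (is "banach_space ?X")
proof -
  interpret vector_space s by fact
  have ring: "cring (scalar_ring :: 'k ring)"
    by (rule cringI)
       (auto simp: scalar_ring_def algebra_simps comm_monoid_def monoid_def comm_monoid_axioms_def
         intro!: abelian_groupI exI[of _ "- x" for x])
  have grp: "abelian_group ?X"
    by (rule abelian_groupI) (auto simp: algebra_simps intro!: exI[of _ "- x" for x])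
  have mod: "Module.module scalar_ring ?X"
    by (rule moduleI[OF ring grp])
       (auto simp: scalar_ring_def scale_left_distrib scale_right_distrib)
  have ns: "normed_space ?X"
    using mod assms(2) by (auto simp: normed_space_def norm_triangle_ineq)
  interpret A: abelian_group ?X by fact
  have "\<ominus>\<^bsub>?X\<^esub> y = - y" for y
    by (rule A.minus_equality) auto
  then have dist: "norm_dist ?X = dist"
    by (auto simp: norm_dist_def a_minus_def dist_norm fun_eq_iff)
  show ?thesis
    using ns Met_TC.mcomplete_of by (simp add: banach_space_def dist complete_UNIV)
qed

text \<open>
  HOL cannot quantify over types inside a formula, so the spaces \<open>Y\<close> range over all Banach space
  structures carried by subsets of \<open>'b + 'k\<close>, with \<open>'b\<close> arbitrary. A Banach space with elements
  in any type \<open>'b\<close> is covered via \<open>Inl\<close>. The summand \<open>'k\<close> ensures that the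
  universe is never too small to contain a nonzero Banach space.
  The supremum is taken in \<open>ennreal\<close>, where the empty supremum is 0.
\<close>

definition admissible ::
    "'b itself \<Rightarrow> ('k::real_normed_field, 'a) normed_space \<Rightarrow> (nat \<Rightarrow> 'a set) \<Rightarrow> bool" where
  "admissible _ X F \<longleftrightarrow>
     (\<forall>(Y :: ('k, 'b + 'k) normed_space) T. banach_space Y \<and> compact_operator X Y T \<longrightarrow>
        limsup (\<lambda>i. SUP f\<in>F i. ennreal (vnorm Y (T f))) = 0)"

definition weakly_null ::
    "('k::real_normed_field, 'a) normed_space \<Rightarrow> (nat \<Rightarrow> 'a set) \<Rightarrow> bool" where
  "weakly_null X F \<longleftrightarrow>
     (\<forall>\<phi>\<in>dual X. \<forall>(i :: nat \<Rightarrow> nat) f. strict_mono i \<and> (\<forall>k. f k \<in> F (i k)) \<longrightarrow>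
        (\<lambda>k. \<phi> (f k)) \<longlonglongrightarrow> 0)"

end

theory Submission
  imports Defs
begin

text \<open>
  A bounded functional is a compact operator into the scalars, so (1) implies (2). Conversely, by a
  gliding hump argument in the dual, weak nullness makes all but finitely many of the sets uniformly
  bounded. If some compact \<open>T\<close> satisfied \<open>\<parallel>T f\<^sub>k\<parallel> > \<epsilon>\<close> along a subsequence, then a
  further subsequence of \<open>T f\<^sub>k\<close> would converge to some \<open>l\<close>. A norming functional \<open>\<psi>\<close> for \<open>l\<close>
  gives \<open>\<psi> \<circ> T\<close> in the dual of \<open>X\<close>, so \<open>\<psi> l = 0\<close> and \<open>l = 0\<close>, a contradiction.

  Norming functionals come from a form of Hahn-Banach without extension steps: every sublinear
  functional dominates a minimal one, and minimal ones are linear, since otherwise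
  \<open>x \<mapsto> INF t\<ge>0. p (x + t a) - t p a\<close> would be a smaller one.
\<close>

section \<open>Real functionals on the scalar field\<close>

text \<open>Nondegeneracy of the real pairing \<open>(c * d) \<bullet> 1\<close>, which for the
  complex numbers is the real part of the product. The test scalar \<open>inverse d\<close> turns
  the pairing into \<open>1 \<bullet> 1 = 1\<close>.\<close>

lemma mult_inner_one_eq_0:
  fixes d :: "'k::{real_normed_field, euclidean_space}"
  assumes "\<And>c. (c * d) \<bullet> 1 = 0"
  shows "d = 0"
proof (rule ccontr)
  assume "d \<noteq> 0"
  with assms[of "inverse d"] show False by simp
qed

text \<open>The map \<open>A\<close> sends \<open>d\<close> to the vector representing the
  functional that pairs with \<open>d\<close>. It is injective by nondegeneracy, hence surjective in
  finite dimension. This treats real and complex scalars at once.\<close>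

lemma real_functional_eq_mult_inner_one:
  fixes f :: "'k::{real_normed_field, euclidean_space} \<Rightarrow> real"
  assumes "linear f"
  obtains d where "\<And>c. f c = (c * d) \<bullet> 1"
proof -
  define A where "A d = adjoint (\<lambda>c::'k. (c * d) \<bullet> 1) 1" for d :: 'k
  have A: "c \<bullet> A d = (c * d) \<bullet> 1" for c d
  proof -
    have "linear (\<lambda>c. (c * d) \<bullet> 1)"
      by (rule linearI) (simp_all add: distrib_right inner_add_left)
    from adjoint_works[OF this, of c 1] show ?thesis by (simp add: A_def)
  qed
  have "linear A"
  proof (rule linearI)
    show "A (d + e) = A d + A e" for d e
      by (subst vector_eq_ldot[symmetric])
        (simp add: A inner_add_right distrib_left inner_add_left)
    show "A (r *\<^sub>R d) = r *\<^sub>R A d" for r d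
      by (subst vector_eq_ldot[symmetric]) (simp add: A)
  qed
  moreover have "inj A"
    unfolding linear_injective_0[OF \<open>linear A\<close>]
    using A by (metis inner_zero_right mult_inner_one_eq_0)
  ultimately have "surj A"
    by (rule linear_injective_imp_surjective) (rule refl)
  then obtain d where d: "A d = adjoint f 1" by (metis surjD)
  have "f c = (c * d) \<bullet> 1" for c
    using adjoint_works[OF assms, of c 1] A[of c d] by (simp add: d)
  then show ?thesis by (rule that)
qed

section \<open>Arithmetic in a carrier-based normed space\<close>

locale carrier_normed_space =
  fixes X :: "('k::{real_normed_field, euclidean_space}, 'v) normed_space" (structure)
  assumes normed_space: "normed_space X"
begin

sublocale Module.module scalar_ring X
  using normed_space by (simp add: normed_space_def)

sublocale metr: Metric_space "carrier X" "norm_dist X"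
  by (rule Metric_space_norm_dist) (rule normed_space)

lemma scalar_closed [simp, intro]: "x \<in> carrier X \<Longrightarrow> c \<odot> x \<in> carrier X"
  using smult_closed[of c x] by (simp add: scalar_ring_def)

lemma scalar_add_left: "x \<in> carrier X \<Longrightarrow> (c + d) \<odot> x = c \<odot> x \<oplus> d \<odot> x"
  using smult_l_distr[of c d x] by (simp add: scalar_ring_def)

lemma scalar_add_right:
  "x \<in> carrier X \<Longrightarrow> y \<in> carrier X \<Longrightarrow> c \<odot> (x \<oplus> y) = c \<odot> x \<oplus> c \<odot> y"
  using smult_r_distr[of c x y] by (simp add: scalar_ring_def)

lemma scalar_scalar: "x \<in> carrier X \<Longrightarrow> c \<odot> (d \<odot> x) = (c * d) \<odot> x"
  using smult_assoc1[of c d x] by (simp add: scalar_ring_def)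

lemma scalar_one [simp]: "x \<in> carrier X \<Longrightarrow> 1 \<odot> x = x"
  using smult_one[of x] by (simp add: scalar_ring_def)

lemma scalar_zero [simp]: "x \<in> carrier X \<Longrightarrow> 0 \<odot> x = \<zero>"
  using smult_l_null[of x] by (simp add: scalar_ring_def)

lemma scalar_minus_one: "x \<in> carrier X \<Longrightarrow> (- 1) \<odot> x = \<ominus> x"
  using scalar_add_left[of x "- 1" 1] by (intro M.minus_equality[symmetric]) auto

lemma vnorm_scalar: "x \<in> carrier X \<Longrightarrow> vnorm X (c \<odot> x) = norm c * vnorm X x"
  using normed_space by (simp add: normed_space_def)

lemma vnorm_triangle:
  "x \<in> carrier X \<Longrightarrow> y \<in> carrier X \<Longrightarrow> vnorm X (x \<oplus> y) \<le> vnorm X x + vnorm X y"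
  using normed_space by (simp add: normed_space_def)

lemma vnorm_eq_0_iff: "x \<in> carrier X \<Longrightarrow> vnorm X x = 0 \<longleftrightarrow> x = \<zero>"
  using normed_space by (simp add: normed_space_def)

lemma vnorm_uminus: "x \<in> carrier X \<Longrightarrow> vnorm X (\<ominus> x) = vnorm X x"
  using vnorm_scalar[of x "- 1"] by (simp add: scalar_minus_one)

lemma norm_dist_eq:
  "x \<in> carrier X \<Longrightarrow> y \<in> carrier X \<Longrightarrow> norm_dist X x y = vnorm X (x \<ominus> y)"
  by (simp add: norm_dist_def)

lemma norm_dist_zero: "x \<in> carrier X \<Longrightarrow> norm_dist X \<zero> x = vnorm X x"
  by (simp add: norm_dist_eq a_minus_def vnorm_uminus)

lemma vnorm_nonneg: "x \<in> carrier X \<Longrightarrow> 0 \<le> vnorm X x"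
  using metr.nonneg[of \<zero> x] by (simp add: norm_dist_zero)

lemma vnorm_le_norm_dist:
  assumes "x \<in> carrier X" "y \<in> carrier X"
  shows "vnorm X x \<le> vnorm X y + norm_dist X y x"
  using metr.triangle[of \<zero> y x] assms by (simp add: norm_dist_zero)

section \<open>Sublinear functionals and real Hahn-Banach\<close>

text \<open>Requiring the value 0 off the carrier makes the pointwise order of functions antisymmetric
  on sublinear functionals.\<close>

definition sublinear :: "('v \<Rightarrow> real) \<Rightarrow> bool" where
  "sublinear p \<longleftrightarrow>
     (\<forall>x\<in>carrier X. \<forall>y\<in>carrier X. p (x \<oplus> y) \<le> p x + p y) \<and>
     (\<forall>t\<ge>0. \<forall>x\<in>carrier X. p (of_real t \<odot> x) \<le> t * p x) \<and>
     (\<forall>x. x \<notin> carrier X \<longrightarrow> p x = 0)"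

lemma sublinear_add:
  "sublinear p \<Longrightarrow> x \<in> carrier X \<Longrightarrow> y \<in> carrier X \<Longrightarrow> p (x \<oplus> y) \<le> p x + p y"
  by (simp add: sublinear_def)

lemma sublinear_off_carrier: "sublinear p \<Longrightarrow> x \<notin> carrier X \<Longrightarrow> p x = 0"
  by (simp add: sublinear_def)

lemma sublinear_zero:
  assumes "sublinear p" shows "p \<zero> = 0"
proof -
  have "p (of_real 0 \<odot> \<zero>) \<le> 0 * p \<zero>"
    using assms unfolding sublinear_def by (meson M.zero_closed order_refl)
  with sublinear_add[OF assms, of \<zero> \<zero>] show ?thesis by simp
qed

lemma sublinear_scale:
  assumes "sublinear p" "0 \<le> t" "x \<in> carrier X"
  shows "p (of_real t \<odot> x) = t * p x"
proof (cases "t = 0")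
  case False
  have le: "p (of_real s \<odot> y) \<le> s * p y" if "0 \<le> s" "y \<in> carrier X" for s y
    using assms(1) that unfolding sublinear_def by blast
  have "p (of_real (1 / t) \<odot> (of_real t \<odot> x)) \<le> (1 / t) * p (of_real t \<odot> x)"
    using assms by (intro le) auto
  with False assms have "t * p x \<le> p (of_real t \<odot> x)"
    by (simp add: scalar_scalar field_simps)
  with le assms show ?thesis by (meson antisym)
qed (use assms in \<open>simp add: sublinear_zero\<close>)

lemma sublinear_uminus_ge:
  assumes "sublinear p" "x \<in> carrier X"
  shows "- p (\<ominus> x) \<le> p x"
  using sublinear_add[OF assms(1), of x "\<ominus> x"] sublinear_zero[OF assms(1)] assms
  by (simp add: M.r_neg)

text \<open>The last property forces every linear functional below \<open>q\<close> to agree with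
  \<open>p\<close> at \<open>a\<close>: take \<open>x = \<ominus> a\<close>. It serves twice:
  applied to a minimal functional it yields additivity, applied to the norm it prescribes the value
  at a given vector.\<close>

lemma sublinear_shift:
  assumes p: "sublinear p" and a: "a \<in> carrier X"
  obtains q where "sublinear q" "q \<le> p"
    and "\<And>x. x \<in> carrier X \<Longrightarrow> q x \<le> p (x \<oplus> a) - p a"
proof -
  define g where "g x t = p (x \<oplus> of_real t \<odot> a) - t * p a" for x t
  define q where "q x = (if x \<in> carrier X then INF t\<in>{0..}. g x t else 0)" for x
  \<comment> \<open>A bound that does not depend on \<open>t\<close>, so that the infimum defining
    \<open>q\<close> is a genuine one.\<close>
  have lower: "- p (\<ominus> x) \<le> g x t" if "x \<in> carrier X" "0 \<le> t" for x t
  proof -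
    have "t * p a = p (\<ominus> x \<oplus> (x \<oplus> of_real t \<odot> a))"
      using that a p by (simp add: M.r_neg1 M.r_neg2 sublinear_scale)
    also have "\<dots> \<le> p (\<ominus> x) + p (x \<oplus> of_real t \<odot> a)"
      using that a by (intro sublinear_add[OF p]) auto
    finally show ?thesis by (simp add: g_def)
  qed
  then have q_le: "q x \<le> g x t" if "x \<in> carrier X" "0 \<le> t" for x t
    using that by (auto simp: q_def intro!: cINF_lower bdd_belowI2)
  have q_greatest: "m \<le> q x" if "x \<in> carrier X" "\<And>t. 0 \<le> t \<Longrightarrow> m \<le> g x t" for m x
    using that by (auto simp: q_def intro!: cINF_greatest)
  \<comment> \<open>Jointly in \<open>x\<close> and \<open>t\<close>, \<open>g\<close> is
    subadditive and positively homogeneous. The infimum over \<open>t\<close> inherits both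
    properties.\<close>
  have g_add: "g (x \<oplus> y) (s + t) \<le> g x s + g y t"
    if "x \<in> carrier X" "y \<in> carrier X" for x y s t
  proof -
    have "x \<oplus> y \<oplus> of_real (s + t) \<odot> a = (x \<oplus> of_real s \<odot> a) \<oplus> (y \<oplus> of_real t \<odot> a)"
      using that a by (simp add: scalar_add_left M.a_ac)
    then show ?thesis
      using sublinear_add[OF p, of "x \<oplus> of_real s \<odot> a" "y \<oplus> of_real t \<odot> a"] that a
      by (simp add: g_def algebra_simps)
  qed
  have g_scale: "g (of_real c \<odot> x) (c * t) = c * g x t"
    if "x \<in> carrier X" "0 \<le> c" for x c t
  proof -
    have "of_real c \<odot> x \<oplus> of_real (c * t) \<odot> a = of_real c \<odot> (x \<oplus> of_real t \<odot> a)"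
      using that a by (simp add: scalar_add_right scalar_scalar)
    then show ?thesis
      using that a by (simp add: g_def sublinear_scale[OF p] algebra_simps)
  qed
  have g_0: "g x 0 = p x" if "x \<in> carrier X" for x
    using that a by (simp add: g_def)
  show ?thesis
  proof
    show "sublinear q"
      unfolding sublinear_def
    proof (intro conjI allI ballI impI)
      fix x y assume xy: "x \<in> carrier X" "y \<in> carrier X"
      have "q (x \<oplus> y) \<le> g x s + g y t" if "0 \<le> s" "0 \<le> t" for s t
        using q_le[of "x \<oplus> y" "s + t"] g_add[OF xy, of s t] xy that by auto
      \<comment> \<open>The two infima are taken one at a time, first over \<open>t\<close> and then
        over \<open>s\<close>, each time with the other term moved to the left.\<close>
      then have "q (x \<oplus> y) - g x s \<le> q y" if "0 \<le> s" for s
        using xy that by (intro q_greatest) (auto simp: algebra_simps)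
      then have "q (x \<oplus> y) - q y \<le> q x"
        using xy by (intro q_greatest) (auto simp: algebra_simps)
      then show "q (x \<oplus> y) \<le> q x + q y" by simp
    next
      fix t :: real and x assume t: "0 \<le> t" and x: "x \<in> carrier X"
      show "q (of_real t \<odot> x) \<le> t * q x"
      proof (cases "t = 0")
        case True
        then show ?thesis
          using q_le[of \<zero> 0] g_0[of \<zero>] sublinear_zero[OF p] x by simp
      next
        case False
        have "q (of_real t \<odot> x) / t \<le> q x"
          using q_le[of "of_real t \<odot> x" "t * s" for s] g_scale[OF x t] x t False
          by (intro q_greatest) (auto simp: field_simps)
        then show ?thesis using t False by (simp add: field_simps)
      qed
    qed (simp add: q_def)
    show "q \<le> p"
      using q_le[of _ 0] g_0 sublinear_off_carrier[OF p] by (auto simp: le_fun_def q_def)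
    show "q x \<le> p (x \<oplus> a) - p a" if "x \<in> carrier X" for x
      using q_le[OF that, of 1] that a by (simp add: g_def)
  qed
qed

text \<open>The pointwise infimum works: it is finite because every member lies above
  \<open>- p (\<ominus> x)\<close> at \<open>x\<close>. The chain condition gives subadditivity,
  since of two members the smaller one can be used at both arguments.\<close>

lemma sublinear_chain_lower_bound:
  assumes "C \<noteq> {}" and C: "\<And>q. q \<in> C \<Longrightarrow> sublinear q \<and> q \<le> p"
    and chain: "\<And>q r. q \<in> C \<Longrightarrow> r \<in> C \<Longrightarrow> q \<le> r \<or> r \<le> q"
  obtains u where "sublinear u" "u \<le> p" "\<And>q. q \<in> C \<Longrightarrow> u \<le> q"
proof -
  define u where "u x = (INF q\<in>C. q x)" for x
  have "bdd_below ((\<lambda>q. q x) ` C)" for x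
  proof (cases "x \<in> carrier X")
    case True
    have "- p (\<ominus> x) \<le> q x" if "q \<in> C" for q
    proof -
      have "q (\<ominus> x) \<le> p (\<ominus> x)" using C[OF that] by (simp add: le_fun_def)
      then show ?thesis using sublinear_uminus_ge[of q x] C[OF that] True by linarith
    qed
    then show ?thesis by (rule bdd_belowI2)
  next
    case False
    then show ?thesis
      using C by (intro bdd_belowI2[of _ 0]) (simp add: sublinear_off_carrier)
  qed
  then have u_le: "u x \<le> q x" if "q \<in> C" for q x
    using that by (auto simp: u_def intro: cINF_lower)
  have u_greatest: "m \<le> u x" if "\<And>q. q \<in> C \<Longrightarrow> m \<le> q x" for m x
    using that assms(1) by (auto simp: u_def intro: cINF_greatest)
  show ?thesis
  proof
    show "sublinear u"
      unfolding sublinear_def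
    proof (intro conjI allI ballI impI)
      fix x y assume xy: "x \<in> carrier X" "y \<in> carrier X"
      have "u (x \<oplus> y) \<le> q x + r y" if qr: "q \<in> C" "r \<in> C" for q r
      proof -
        obtain s where s: "s \<in> C" "s \<le> q" "s \<le> r"
          using chain[OF qr] qr by auto
        have "u (x \<oplus> y) \<le> s (x \<oplus> y)" by (rule u_le) fact
        also have "\<dots> \<le> s x + s y" using C[OF s(1)] xy by (simp add: sublinear_add)
        also have "\<dots> \<le> q x + r y" using s by (simp add: le_fun_def add_mono)
        finally show ?thesis .
      qed
      then have "u (x \<oplus> y) - q x \<le> u y" if "q \<in> C" for q
        using that by (intro u_greatest) (simp add: diff_le_eq add.commute[of "_ y"])
      then have "u (x \<oplus> y) - u y \<le> u x"
        by (intro u_greatest) (simp add: diff_le_eq add.commute)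
      then show "u (x \<oplus> y) \<le> u x + u y" by simp
    next
      fix t :: real and x assume t: "0 \<le> t" and x: "x \<in> carrier X"
      have le: "u (of_real t \<odot> x) \<le> t * q x" if "q \<in> C" for q
        using u_le[OF that, of "of_real t \<odot> x"] C[OF that] t x by (simp add: sublinear_scale)
      show "u (of_real t \<odot> x) \<le> t * u x"
      proof (cases "t = 0")
        case True
        then show ?thesis using le assms(1) by auto
      next
        case False
        have "u (of_real t \<odot> x) / t \<le> u x"
          using le t False by (intro u_greatest) (auto simp: field_simps)
        then show ?thesis using t False by (simp add: field_simps)
      qed
    next
      fix x assume "x \<notin> carrier X"
      then show "u x = 0"
        using C assms(1) unfolding u_def by (simp add: sublinear_off_carrier cong: INF_cong)
    qed
    show "u \<le> p"
      using assms(1) C u_le by (metis ex_in_conv le_funI order_trans)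
    show "u \<le> q" if "q \<in> C" for q
      using u_le[OF that] by (simp add: le_fun_def)
  qed
qed

lemma minimal_sublinear:
  assumes "sublinear p"
  obtains m where "sublinear m" "m \<le> p" "\<And>q. sublinear q \<Longrightarrow> q \<le> m \<Longrightarrow> q = m"
proof -
  let ?A = "{q. sublinear q \<and> q \<le> p}"
  have "\<exists>m\<in>?A. \<forall>a\<in>?A. m \<ge> a \<longrightarrow> a = m"
  proof (rule predicate_Zorn)
    \<comment> \<open>Zorn's lemma is applied to the reversed order, so that its maximal element is
      a minimal functional.\<close>
    show "partial_order_on ?A (relation_of (\<ge>) ?A)"
      by (rule partial_order_on_relation_ofI) auto
    fix C assume C: "C \<in> Chains (relation_of (\<ge>) ?A)"
    show "\<exists>u\<in>?A. \<forall>a\<in>C. u \<le> a"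
    proof (cases "C = {}")
      case True
      then show ?thesis using assms by auto
    next
      case False
      have "sublinear q \<and> q \<le> p" if "q \<in> C" for q
        using C that by (auto simp: Chains_def relation_of_def)
      moreover have "q \<le> r \<or> r \<le> q" if "q \<in> C" "r \<in> C" for q r
        using C that by (auto simp: Chains_def relation_of_def)
      ultimately obtain u where "sublinear u" "u \<le> p" "\<And>q. q \<in> C \<Longrightarrow> u \<le> q"
        by (rule sublinear_chain_lower_bound[OF False]) blast+
      then show ?thesis by auto
    qed
  qed
  then obtain m where "sublinear m" "m \<le> p" and m: "\<And>q. q \<in> ?A \<Longrightarrow> q \<le> m \<Longrightarrow> q = m"
    by blast
  have min: "q = m" if "sublinear q" "q \<le> m" for q
    using that m[of q] order_trans[OF that(2) \<open>m \<le> p\<close>] by simp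
  show ?thesis by (rule that[OF \<open>sublinear m\<close> \<open>m \<le> p\<close> min])
qed

text \<open>For a minimal \<open>m\<close>, the shifted functional must be \<open>m\<close> itself,
  and its defining bound becomes the inequality opposite to subadditivity. Additivity then extends
  homogeneity to negative scalars.\<close>

lemma real_linear_below_sublinear:
  assumes "sublinear p"
  obtains \<rho> where "\<And>x. x \<in> carrier X \<Longrightarrow> \<rho> x \<le> p x"
    and "\<And>x y. x \<in> carrier X \<Longrightarrow> y \<in> carrier X \<Longrightarrow> \<rho> (x \<oplus> y) = \<rho> x + \<rho> y"
    and "\<And>t x. x \<in> carrier X \<Longrightarrow> \<rho> (of_real t \<odot> x) = t * \<rho> x"
proof -
  obtain m where m: "sublinear m" "m \<le> p" and min: "\<And>q. sublinear q \<Longrightarrow> q \<le> m \<Longrightarrow> q = m"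
    by (rule minimal_sublinear[OF assms]) blast
  have add: "m (x \<oplus> a) = m x + m a" if x: "x \<in> carrier X" and a: "a \<in> carrier X" for x a
  proof -
    obtain q where "sublinear q" "q \<le> m"
      and q: "\<And>x. x \<in> carrier X \<Longrightarrow> q x \<le> m (x \<oplus> a) - m a"
      using sublinear_shift[OF m(1) a] by blast
    then have "q = m" by (intro min)
    with q[OF x] sublinear_add[OF m(1) x a] show ?thesis by simp
  qed
  have scale: "m (of_real t \<odot> x) = t * m x" if x: "x \<in> carrier X" for t x
  proof (cases "0 \<le> t")
    case True
    then show ?thesis by (rule sublinear_scale[OF m(1) _ x])
  next
    case False
    have "m (of_real (- t) \<odot> x) + m (of_real t \<odot> x) = 0"
      using add[of "of_real (- t) \<odot> x" "of_real t \<odot> x"] x sublinear_zero[OF m(1)]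
        scalar_add_left[OF x, of "of_real (- t)" "of_real t"]
      by simp
    moreover have "m (of_real (- t) \<odot> x) = - t * m x"
      using False by (intro sublinear_scale[OF m(1) _ x]) simp
    ultimately show ?thesis by simp
  qed
  show ?thesis
    by (rule that[of m]) (use m add scale in \<open>auto simp: le_fun_def\<close>)
qed

section \<open>Norming functionals\<close>

text \<open>The norm is shifted along \<open>z\<close> before a linear functional is taken below it.
  At \<open>\<ominus> z\<close> the shifted functional is at most \<open>- vnorm X z\<close>, which
  forces \<open>\<rho> z\<close> up to the norm of \<open>z\<close>.\<close>

lemma real_linear_norming:
  assumes "z \<in> carrier X"
  obtains \<rho> where "\<And>x. x \<in> carrier X \<Longrightarrow> \<rho> x \<le> vnorm X x"
    and "\<And>x y. x \<in> carrier X \<Longrightarrow> y \<in> carrier X \<Longrightarrow> \<rho> (x \<oplus> y) = \<rho> x + \<rho> y"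
    and "\<And>t x. x \<in> carrier X \<Longrightarrow> \<rho> (of_real t \<odot> x) = t * \<rho> x"
    and "\<rho> z = vnorm X z"
proof -
  define N where "N x = (if x \<in> carrier X then vnorm X x else 0)" for x
  have "sublinear N"
    by (auto simp: sublinear_def N_def vnorm_triangle vnorm_scalar)
  then obtain p where p: "sublinear p" "p \<le> N"
    and shift: "\<And>x. x \<in> carrier X \<Longrightarrow> p x \<le> N (x \<oplus> z) - N z"
    using sublinear_shift[OF _ assms] by blast
  obtain \<rho> where \<rho>: "\<And>x. x \<in> carrier X \<Longrightarrow> \<rho> x \<le> p x"
    and add: "\<And>x y. x \<in> carrier X \<Longrightarrow> y \<in> carrier X \<Longrightarrow> \<rho> (x \<oplus> y) = \<rho> x + \<rho> y"
    and scale: "\<And>t x. x \<in> carrier X \<Longrightarrow> \<rho> (of_real t \<odot> x) = t * \<rho> x"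
    using real_linear_below_sublinear[OF p(1)] by blast
  have le: "\<rho> x \<le> vnorm X x" if "x \<in> carrier X" for x
    using \<rho>[OF that] le_funD[OF p(2), of x] that by (simp add: N_def)
  have "\<rho> (\<ominus> z) \<le> - vnorm X z"
    using order_trans[OF \<rho> shift, of "\<ominus> z"] assms vnorm_eq_0_iff[of \<zero>] by (simp add: N_def M.l_neg)
  moreover have "\<rho> (\<ominus> z) = - \<rho> z"
    using scale[OF assms, of "- 1"] assms by (simp add: scalar_minus_one)
  ultimately have "\<rho> z = vnorm X z"
    using le[OF assms] by simp
  from that[OF le add scale this] show ?thesis .
qed

text \<open>The scalar-valued functional is the unique one whose pairing with 1 gives \<open>\<rho>\<close>, as in the passage
  from real to complex functionals.\<close>

lemma norming_functional:
  assumes z: "z \<in> carrier X"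
  obtains \<phi> where "linear_operator X scalar_space \<phi>"
    and "\<And>x. x \<in> carrier X \<Longrightarrow> norm (\<phi> x) \<le> vnorm X x"
    and "norm (\<phi> z) = vnorm X z"
proof -
  obtain \<rho> where le: "\<And>x. x \<in> carrier X \<Longrightarrow> \<rho> x \<le> vnorm X x"
    and add: "\<And>x y. x \<in> carrier X \<Longrightarrow> y \<in> carrier X \<Longrightarrow> \<rho> (x \<oplus> y) = \<rho> x + \<rho> y"
    and scale: "\<And>t x. x \<in> carrier X \<Longrightarrow> \<rho> (of_real t \<odot> x) = t * \<rho> x"
    and z_eq: "\<rho> z = vnorm X z"
    using real_linear_norming[OF z] by blast
  have "\<exists>d. \<forall>c. \<rho> (c \<odot> x) = (c * d) \<bullet> 1" if x: "x \<in> carrier X" for x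
  proof -
    have "linear (\<lambda>c. \<rho> (c \<odot> x))"
      using x scale[of "c \<odot> x" for c]
      by (intro linearI) (simp_all add: scalar_add_left add scalar_scalar scaleR_conv_of_real)
    then show ?thesis by (metis real_functional_eq_mult_inner_one)
  qed
  then obtain \<phi> where \<phi>: "\<And>x c. x \<in> carrier X \<Longrightarrow> \<rho> (c \<odot> x) = (c * \<phi> x) \<bullet> 1"
    by metis
  have unique: "d = e" if "\<And>c. (c * d) \<bullet> 1 = (c * e) \<bullet> 1" for d e :: 'k
    using mult_inner_one_eq_0[of "d - e"] that by (simp add: right_diff_distrib inner_diff_left)
  have bound: "norm (\<phi> x) \<le> vnorm X x" if x: "x \<in> carrier X" for x
  proof (cases "\<phi> x = 0")
    case False
    \<comment> \<open>Scaling by \<open>inverse (\<phi> x)\<close> moves the value of the functional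
      to 1, where the pairing loses nothing. In the complex case this is the usual rotation
      argument.\<close>
    have "1 = \<rho> (inverse (\<phi> x) \<odot> x)"
      using False \<phi>[OF x] by (simp add: norm_eq_1[symmetric])
    also have "\<dots> \<le> inverse (norm (\<phi> x)) * vnorm X x"
      using le[of "inverse (\<phi> x) \<odot> x"] x by (simp add: vnorm_scalar norm_inverse)
    finally show ?thesis using False by (simp add: field_simps)
  qed (simp add: vnorm_nonneg x)
  show ?thesis
  proof
    show "linear_operator X scalar_space \<phi>"
      unfolding linear_operator_def scalar_space_def
    proof (simp, intro conjI ballI allI)
      show "\<phi> (x \<oplus> y) = \<phi> x + \<phi> y" if "x \<in> carrier X" "y \<in> carrier X" for x y
      proof (rule unique)
        show "(c * \<phi> (x \<oplus> y)) \<bullet> 1 = (c * (\<phi> x + \<phi> y)) \<bullet> 1" for c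
          using that
          by (simp add: \<phi>[symmetric] scalar_add_right add distrib_left inner_add_left)
      qed
      show "\<phi> (d \<odot> x) = d * \<phi> x" if "x \<in> carrier X" for d x
      proof (rule unique)
        show "(c * \<phi> (d \<odot> x)) \<bullet> 1 = (c * (d * \<phi> x)) \<bullet> 1" for c
          using that \<phi>[of x "c * d"] by (simp add: \<phi>[symmetric] scalar_scalar mult.assoc)
      qed
    qed
    show "norm (\<phi> x) \<le> vnorm X x" if "x \<in> carrier X" for x
      by (rule bound) fact
    \<comment> \<open>The pairing with 1 can only decrease the modulus, so \<open>\<phi> z\<close>
      is at least as large as \<open>\<rho> z\<close>.\<close>
    have "vnorm X z = \<phi> z \<bullet> 1"
      using \<phi>[OF z, of 1] z z_eq by simp
    also have "\<dots> \<le> norm (\<phi> z)"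
      using norm_cauchy_schwarz[of "\<phi> z" 1] by simp
    finally show "norm (\<phi> z) = vnorm X z"
      using bound[OF z] by simp
  qed
qed

section \<open>Bounded functionals and the dual\<close>

text \<open>A nonzero \<open>x\<close> is rescaled to norm \<open>\<delta>\<close>. Leaving
  \<open>q\<close> abstract lets the same argument bound continuous functionals and compact
  operators.\<close>

lemma homogeneous_bound:
  assumes hom: "\<And>t x. x \<in> carrier X \<Longrightarrow> q (of_real t \<odot> x) = \<bar>t\<bar> * q x"
    and \<delta>: "0 < \<delta>" "\<And>x. x \<in> carrier X \<Longrightarrow> vnorm X x \<le> \<delta> \<Longrightarrow> q x \<le> C"
    and x: "x \<in> carrier X"
  shows "q x \<le> C / \<delta> * vnorm X x"
proof (cases "vnorm X x = 0")
  case True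
  then have "x = \<zero>" using vnorm_eq_0_iff x by simp
  then have "q x = 0" using hom[of \<zero> 0] by simp
  with True show ?thesis by simp
next
  case False
  then have pos: "0 < vnorm X x" using vnorm_nonneg[OF x] by simp
  have "q (of_real (\<delta> / vnorm X x) \<odot> x) \<le> C"
    using pos x \<delta>(1) by (intro \<delta>(2)) (simp_all add: vnorm_scalar norm_divide)
  then have "\<delta> / vnorm X x * q x \<le> C"
    using pos \<delta>(1) by (simp only: hom[OF x]) simp
  then show ?thesis using pos \<delta>(1) by (simp add: field_simps)
qed

lemma dual_iff_bounded:
  "\<phi> \<in> dual X \<longleftrightarrow> linear_operator X scalar_space \<phi> \<and>
     (\<exists>C. \<forall>x\<in>carrier X. norm (\<phi> x) \<le> C * vnorm X x)"
proof (cases "linear_operator X scalar_space \<phi>")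
  case True
  then have add: "\<phi> (x \<oplus> y) = \<phi> x + \<phi> y"
    and scale: "\<phi> (c \<odot> x) = c * \<phi> x" if "x \<in> carrier X" "y \<in> carrier X" for x y c
    using that by (auto simp: linear_operator_def scalar_space_def)
  have zero: "\<phi> \<zero> = 0"
    using scale[of \<zero> \<zero> 0] by simp
  have diff: "\<phi> (x \<ominus> y) = \<phi> x - \<phi> y" if "x \<in> carrier X" "y \<in> carrier X" for x y
    using add[of x "(- 1) \<odot> y"] scale[of y y "- 1"] that
    by (simp add: a_minus_def scalar_minus_one)
  have "continuous_map (norm_topology X) euclidean \<phi> \<longleftrightarrow>
    (\<forall>a\<in>carrier X. \<forall>\<epsilon>>0. \<exists>\<delta>>0. \<forall>x. x \<in> carrier X \<and> norm_dist X a x < \<delta> \<longrightarrow> dist (\<phi> a) (\<phi> x) < \<epsilon>)"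
    using metr.metric_continuous_map[OF Met_TC.Metric_space_axioms, of \<phi>] by simp
  also have "\<dots> \<longleftrightarrow> (\<exists>C. \<forall>x\<in>carrier X. norm (\<phi> x) \<le> C * vnorm X x)" (is "?L = ?R")
  proof
    assume ?L
    then obtain \<delta> where \<delta>: "\<delta> > 0" "\<And>x. x \<in> carrier X \<Longrightarrow> norm_dist X \<zero> x < \<delta> \<Longrightarrow> dist (\<phi> \<zero>) (\<phi> x) < 1"
      by (meson M.zero_closed zero_less_one)
    \<comment> \<open>Continuity controls an open ball, whereas \<open>homogeneous_bound\<close>
      asks for a closed one; hence the radius \<open>\<delta> / 2\<close>.\<close>
    have "norm (\<phi> x) \<le> 1 / (\<delta> / 2) * vnorm X x" if "x \<in> carrier X" for x
    proof (rule homogeneous_bound[OF _ _ _ that])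
      show "norm (\<phi> y) \<le> 1" if "y \<in> carrier X" "vnorm X y \<le> \<delta> / 2" for y
        using \<delta>(2)[of y] \<delta>(1) that by (simp add: norm_dist_zero zero)
    qed (use \<delta> scale in \<open>auto simp: norm_mult\<close>)
    then show ?R by blast
  next
    assume ?R
    then obtain C where C: "\<And>x. x \<in> carrier X \<Longrightarrow> norm (\<phi> x) \<le> C * vnorm X x" by blast
    show ?L
    proof (intro ballI allI impI)
      fix a and \<epsilon> :: real assume a: "a \<in> carrier X" and \<epsilon>: "\<epsilon> > 0"
      \<comment> \<open>The constant \<open>C\<close> may be zero or negative, so
        \<open>\<bar>C\<bar> + 1\<close> serves as a positive Lipschitz constant.\<close>
      have "dist (\<phi> a) (\<phi> x) < \<epsilon>"
        if x: "x \<in> carrier X" "norm_dist X a x < \<epsilon> / (\<bar>C\<bar> + 1)" for x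
      proof -
        have "dist (\<phi> a) (\<phi> x) \<le> C * norm_dist X a x"
          using C[of "a \<ominus> x"] a x by (simp add: dist_norm diff norm_dist_eq)
        also have "\<dots> \<le> (\<bar>C\<bar> + 1) * norm_dist X a x"
          by (intro mult_right_mono metr.nonneg) simp
        also have "\<dots> < \<epsilon>"
          using x(2) by (simp add: pos_less_divide_eq mult.commute)
        finally show ?thesis .
      qed
      moreover have "\<epsilon> / (\<bar>C\<bar> + 1) > 0" using \<epsilon> by simp
      ultimately show "\<exists>\<delta>>0. \<forall>x. x \<in> carrier X \<and> norm_dist X a x < \<delta> \<longrightarrow> dist (\<phi> a) (\<phi> x) < \<epsilon>"
        by blast
    qed
  qed
  finally show ?thesis using True by (simp add: dual_def)
qed (simp add: dual_def)

section \<open>Gliding hump and eventual boundedness\<close>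

text \<open>Gliding hump: the functional is \<open>\<Sum>n. s n * \<psi> n\<close> with \<open>\<psi> n\<close> norming for \<open>y n\<close> and
  \<open>norm (s n) = (1/3) ^ n\<close>. The sign of \<open>s n\<close> keeps the partial sum up to \<open>n\<close> large at \<open>y n\<close>, and the
  remaining terms take away at most half of its value.\<close>

lemma functional_large_on_sequence:
  assumes y: "\<And>n. y n \<in> carrier X" and large: "\<And>n. 2 * 3 ^ n \<le> vnorm X (y n)"
  obtains \<phi> where "\<phi> \<in> dual X" "\<And>n. 1 \<le> norm (\<phi> (y n))"
proof -
  have "\<exists>\<psi>. linear_operator X scalar_space \<psi> \<and> (\<forall>x\<in>carrier X. norm (\<psi> x) \<le> vnorm X x) \<and>
      norm (\<psi> (y n)) = vnorm X (y n)" for n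
    by (rule norming_functional[OF y[of n]]) blast
  then obtain \<psi> where \<psi>: "\<forall>n. linear_operator X scalar_space (\<psi> n) \<and>
      (\<forall>x\<in>carrier X. norm (\<psi> n x) \<le> vnorm X x) \<and> norm (\<psi> n (y n)) = vnorm X (y n)"
    by metis
  then have lin: "linear_operator X scalar_space (\<psi> n)"
    and le: "x \<in> carrier X \<Longrightarrow> norm (\<psi> n x) \<le> vnorm X x"
    and eq: "norm (\<psi> n (y n)) = vnorm X (y n)" for n x
    by auto
  have \<psi>_add: "\<psi> n (x \<oplus> x') = \<psi> n x + \<psi> n x'"
    and \<psi>_scale: "\<psi> n (c \<odot> x) = c * \<psi> n x"
    if "x \<in> carrier X" "x' \<in> carrier X" for n x x' c
    using lin[of n] that by (auto simp: linear_operator_def scalar_space_def)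
  \<comment> \<open>\<open>Q n g g'\<close> describes one step of the recursion: \<open>g'\<close>
    is the partial sum after \<open>g\<close>, and its new term is not cancelled at
    \<open>y n\<close>.\<close>
  define Q where "Q n g g' \<longleftrightarrow> (\<exists>s. norm s = (1/3) ^ n \<and> (\<forall>x. g' x = g x + s * \<psi> n x)) \<and>
    (1/3) ^ n * vnorm X (y n) \<le> norm (g' (y n))" for n and g g' :: "'v \<Rightarrow> 'k"
  have "\<exists>g. \<forall>n. (n = 0 \<longrightarrow> g n = (\<lambda>_. 0)) \<and> Q n (g n) (g (Suc n))"
  proof (rule dependent_nat_choice)
    fix g :: "'v \<Rightarrow> 'k" and n
    let ?t = "of_real ((1/3) ^ n) :: 'k"
    let ?a = "g (y n)" and ?b = "?t * \<psi> n (y n)"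
    have t: "norm ?t = (1/3) ^ n" by (simp only: norm_of_real) simp
    \<comment> \<open>Since \<open>2 b = (a + b) - (a - b)\<close>, at least one of the two sign
      choices has modulus at least that of \<open>b\<close>.\<close>
    have "norm (?b + ?b) \<le> norm (?a + ?b) + norm (?a + - ?t * \<psi> n (y n))"
      using norm_triangle_ineq4[of "?a + ?b" "?a - ?b"] by (simp add: algebra_simps)
    moreover have "norm (?b + ?b) = 2 * norm ?b"
      by (metis mult_2 norm_mult norm_numeral)
    moreover have "norm ?b = (1/3) ^ n * vnorm X (y n)"
      by (simp only: norm_mult t eq)
    ultimately consider "(1/3) ^ n * vnorm X (y n) \<le> norm (?a + ?t * \<psi> n (y n))"
      | "(1/3) ^ n * vnorm X (y n) \<le> norm (?a + - ?t * \<psi> n (y n))"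
      by linarith
    then obtain s where "norm s = (1/3) ^ n" "(1/3) ^ n * vnorm X (y n) \<le> norm (?a + s * \<psi> n (y n))"
      by cases (metis t, metis t norm_minus_cancel)
    then have "Q n g (\<lambda>x. g x + s * \<psi> n x)" by (auto simp: Q_def)
    then show "\<exists>g'. (Suc n = 0 \<longrightarrow> g' = (\<lambda>_. 0)) \<and> Q n g g'" by blast
  qed auto
  then obtain g where g_0: "g 0 = (\<lambda>_. 0)" and Q: "\<And>n. Q n (g n) (g (Suc n))" by blast
  then obtain s where s: "\<And>n. norm (s n) = (1/3) ^ n" "\<And>n x. g (Suc n) x = g n x + s n * \<psi> n x"
    unfolding Q_def by metis
  have g: "g n x = (\<Sum>j<n. s j * \<psi> j x)" for n x
    by (induction n) (simp_all add: g_0 s(2))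
  have term_le: "norm (s j * \<psi> j x) \<le> (1/3) ^ j * vnorm X x" if "x \<in> carrier X" for j x
    using le[OF that] by (simp add: norm_mult s(1) mult_left_mono)
  have geom: "summable (\<lambda>j. (1/3) ^ (j + n) * vnorm X x)" for n x
    by (intro summable_mult2) (simp add: summable_geometric power_add summable_mult2)
  have norm_summable: "summable (\<lambda>j. norm (s (j + n) * \<psi> (j + n) x))" if "x \<in> carrier X" for n x
    using term_le[OF that] by (intro summable_comparison_test'[OF geom]) simp
  have summ: "summable (\<lambda>j. s j * \<psi> j x)" if "x \<in> carrier X" for x
    using summable_norm_cancel[OF norm_summable[OF that, of 0]] unfolding add_0_right .
  define \<phi> where "\<phi> x = (\<Sum>j. s j * \<psi> j x)" for x
  \<comment> \<open>The constant is the geometric sum of \<open>(1/3) ^ j\<close> from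
    \<open>j = n\<close> on. For \<open>n = 0\<close> it also shows that \<open>\<phi>\<close> is
    bounded.\<close>
  have tail: "norm (\<phi> x - g n x) \<le> 3/2 * (1/3) ^ n * vnorm X x" if x: "x \<in> carrier X" for n x
  proof -
    have "norm (\<phi> x - g n x) = norm (\<Sum>j. s (j + n) * \<psi> (j + n) x)"
      using suminf_minus_initial_segment[OF summ[OF x], of n] by (simp add: \<phi>_def g)
    also have "\<dots> \<le> (\<Sum>j. norm (s (j + n) * \<psi> (j + n) x))"
      by (rule summable_norm[OF norm_summable[OF x]])
    also have "\<dots> \<le> (\<Sum>j. (1/3) ^ (j + n) * vnorm X x)"
      by (rule suminf_le[OF term_le[OF x] norm_summable[OF x] geom])
    also have "\<dots> = (\<Sum>j. (1/3) ^ j * ((1/3) ^ n * vnorm X x))"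
      by (simp add: power_add mult.assoc)
    also have "\<dots> = (\<Sum>j. (1/3) ^ j) * ((1/3) ^ n * vnorm X x)"
      by (rule suminf_mult2[symmetric]) (simp add: summable_geometric)
    also have "\<dots> = 3/2 * (1/3) ^ n * vnorm X x"
      by (simp add: suminf_geometric)
    finally show ?thesis .
  qed
  show ?thesis
  proof
    have "linear_operator X scalar_space \<phi>"
      using summ
      by (auto simp: linear_operator_def scalar_space_def \<phi>_def \<psi>_add \<psi>_scale distrib_left
          mult.left_commute suminf_add suminf_mult)
    moreover have "\<forall>x\<in>carrier X. norm (\<phi> x) \<le> 3/2 * vnorm X x"
      using tail[of _ 0] by (simp add: g_0)
    ultimately show "\<phi> \<in> dual X" unfolding dual_iff_bounded by blast
    show "1 \<le> norm (\<phi> (y n))" for n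
    proof -
      have "(1/3) ^ n * vnorm X (y n) \<le> norm (g (Suc n) (y n))"
        using Q[of n] by (simp add: Q_def)
      moreover have "norm (g (Suc n) (y n)) \<le> norm (\<phi> (y n)) + norm (\<phi> (y n) - g (Suc n) (y n))"
        using norm_triangle_sub[of "g (Suc n) (y n)" "\<phi> (y n)"] by (simp add: norm_minus_commute)
      \<comment> \<open>The partial sum containing the term of index \<open>n\<close> is
        \<open>g (Suc n)\<close>; the additional factor 1/3 turns 3/2 into 1/2. At least half of a
        quantity no smaller than 2 therefore survives.\<close>
      moreover have "norm (\<phi> (y n) - g (Suc n) (y n)) \<le> 1/2 * ((1/3) ^ n * vnorm X (y n))"
        using tail[OF y, of n "Suc n"] by simp
      moreover have "2 \<le> (1/3) ^ n * vnorm X (y n)"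
        using large[of n] by (simp add: power_divide field_simps)
      ultimately show ?thesis by linarith
    qed
  qed
qed

text \<open>If every tail were unbounded, elements with norms at least \<open>2 * 3 ^ n\<close>
  could be picked at increasing indices, and the gliding hump functional would stay away from 0 on
  them. Finitely many of the sets may still be unbounded, hence the threshold
  \<open>N\<close>.\<close>

lemma weakly_null_eventually_bounded:
  assumes "weakly_null X F" and F: "\<And>i. F i \<subseteq> carrier X"
  obtains C N where "\<And>i f. i \<ge> N \<Longrightarrow> f \<in> F i \<Longrightarrow> vnorm X f \<le> C"
proof (rule ccontr)
  assume "\<not> thesis"
  with that have unbounded: "\<exists>i f. i \<ge> N \<and> f \<in> F i \<and> C < vnorm X f" for N C
    by (meson not_le)
  \<comment> \<open>Each \<open>h n\<close> is a pair of an index and an element of the set with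
    that index, so one recursion chooses both.\<close>
  have "\<exists>h. \<forall>n. (snd (h n) \<in> F (fst (h n)) \<and> 2 * 3 ^ n \<le> vnorm X (snd (h n))) \<and>
      fst (h n) < fst (h (Suc n))"
  proof (rule dependent_nat_choice)
    show "\<exists>h. snd h \<in> F (fst h) \<and> 2 * 3 ^ 0 \<le> vnorm X (snd h)"
      using unbounded[of 0 2] by (auto intro: less_imp_le)
    show "\<exists>h'. (snd h' \<in> F (fst h') \<and> 2 * 3 ^ Suc n \<le> vnorm X (snd h')) \<and> fst h < fst h'"
      for h :: "nat \<times> 'v" and n
      using unbounded[of "Suc (fst h)" "2 * 3 ^ Suc n"] by (auto simp: Suc_le_eq intro: less_imp_le)
  qed
  then obtain h where h: "\<And>n. snd (h n) \<in> F (fst (h n))" "\<And>n. 2 * 3 ^ n \<le> vnorm X (snd (h n))"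
    "\<And>n. fst (h n) < fst (h (Suc n))"
    by blast
  have "snd (h n) \<in> carrier X" for n using h(1) F by blast
  then obtain \<phi> where "\<phi> \<in> dual X" and \<phi>: "\<And>n. 1 \<le> norm (\<phi> (snd (h n)))"
    using functional_large_on_sequence[of "\<lambda>n. snd (h n)"] h(2) by blast
  moreover have "strict_mono (\<lambda>n. fst (h n))"
    using h(3) by (simp add: strict_mono_Suc_iff)
  ultimately have "(\<lambda>n. \<phi> (snd (h n))) \<longlonglongrightarrow> 0"
    using assms(1)[unfolded weakly_null_def, rule_format, of \<phi> "\<lambda>n. fst (h n)" "\<lambda>n. snd (h n)"] h(1)
    by blast
  then have "\<forall>\<^sub>F n in sequentially. norm (\<phi> (snd (h n))) < 1"
    by (auto dest: tendstoD[of _ _ _ 1])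
  then show False
    using \<phi> by (auto simp: eventually_sequentially not_le[symmetric])
qed

end

section \<open>Weakly null sequences are admissible\<close>

text \<open>The image of the unit ball has compact closure and so lies in some ball. Its centre
  \<open>a\<close> need not be zero, which adds \<open>vnorm Y a\<close> to the radius.\<close>

lemma compact_operator_bounded:
  fixes X :: "('k::{real_normed_field, euclidean_space}, 'a) normed_space"
    and Y :: "('k, 'b) normed_space"
  assumes "normed_space X" "normed_space Y" and T: "compact_operator X Y T"
  obtains C where "\<And>x. x \<in> carrier X \<Longrightarrow> vnorm Y (T x) \<le> C * vnorm X x"
proof -
  interpret X: carrier_normed_space X by unfold_locales fact
  interpret Y: carrier_normed_space Y by unfold_locales fact
  have closed: "T x \<in> carrier Y" and scale: "T (c \<odot>\<^bsub>X\<^esub> x) = c \<odot>\<^bsub>Y\<^esub> T x"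
    if "x \<in> carrier X" for x c
    using T that by (auto simp: compact_operator_def linear_operator_def)
  let ?B = "{x \<in> carrier X. vnorm X x \<le> 1}"
  have "?B \<subseteq> carrier X \<and> (\<exists>C. \<forall>x\<in>?B. vnorm X x \<le> C)" by auto
  with T have "compactin Y.metr.mtopology (Y.metr.mtopology closure_of (T ` ?B))"
    unfolding compact_operator_def Y.metr.mtopology_of by blast
  moreover have "T ` ?B \<subseteq> Y.metr.mtopology closure_of (T ` ?B)"
    using closed by (intro closure_of_subset) auto
  ultimately have "Y.metr.mbounded (T ` ?B)"
    using Y.metr.compactin_imp_mbounded Y.metr.mbounded_subset by blast
  then obtain a r where ball: "T ` ?B \<subseteq> Y.metr.mcball a r"
    by (auto simp: Y.metr.mbounded_def)
  have "vnorm Y (T x) \<le> vnorm Y a + r" if "x \<in> carrier X" "vnorm X x \<le> 1" for x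
  proof -
    have "T x \<in> Y.metr.mcball a r" using ball that by blast
    then show ?thesis using Y.vnorm_le_norm_dist[of "T x" a] by simp
  qed
  then have "vnorm Y (T x) \<le> (vnorm Y a + r) / 1 * vnorm X x" if "x \<in> carrier X" for x
    using that by (intro X.homogeneous_bound) (auto simp: scale closed Y.vnorm_scalar)
  then show ?thesis by (rule that)
qed

lemma dual_comp_bounded_operator:
  fixes X :: "('k::{real_normed_field, euclidean_space}, 'a) normed_space"
    and Y :: "('k, 'b) normed_space"
  assumes "normed_space X" "normed_space Y" and T: "linear_operator X Y T"
    and C: "\<And>x. x \<in> carrier X \<Longrightarrow> vnorm Y (T x) \<le> C * vnorm X x"
    and \<psi>: "linear_operator Y scalar_space \<psi>" "\<And>y. y \<in> carrier Y \<Longrightarrow> norm (\<psi> y) \<le> vnorm Y y"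
  shows "(\<lambda>x. \<psi> (T x)) \<in> dual X"
proof -
  interpret X: carrier_normed_space X by unfold_locales fact
  have "linear_operator X scalar_space (\<lambda>x. \<psi> (T x))"
    using T \<psi>(1) unfolding linear_operator_def by (auto simp: Pi_iff)
  moreover have "norm (\<psi> (T x)) \<le> C * vnorm X x" if "x \<in> carrier X" for x
    using C[OF that] \<psi>(2)[of "T x"] T that by (force simp: linear_operator_def)
  ultimately show ?thesis unfolding X.dual_iff_bounded by blast
qed

lemma compact_operator_eventually_small:
  fixes X :: "('k::{real_normed_field, euclidean_space}, 'a) normed_space"
    and Y :: "('k, 'b) normed_space"
  assumes X: "normed_space X" and Y: "normed_space Y" and T: "compact_operator X Y T"
    and F: "\<And>i. F i \<subseteq> carrier X" and wn: "weakly_null X F" and \<epsilon>: "\<epsilon> > 0"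
  shows "\<forall>\<^sub>F i in sequentially. \<forall>f\<in>F i. vnorm Y (T f) \<le> \<epsilon>"
proof (rule ccontr)
  interpret X: carrier_normed_space X by unfold_locales fact
  interpret Y: carrier_normed_space Y by unfold_locales fact
  have lin: "linear_operator X Y T" using T by (simp add: compact_operator_def)
  then have closed: "T x \<in> carrier Y" if "x \<in> carrier X" for x
    using that by (auto simp: linear_operator_def)
  assume "\<not> (\<forall>\<^sub>F i in sequentially. \<forall>f\<in>F i. vnorm Y (T f) \<le> \<epsilon>)"
  then have large: "\<exists>i f. i \<ge> N \<and> f \<in> F i \<and> \<epsilon> < vnorm Y (T f)" for N
    by (force simp: eventually_sequentially not_le)
  \<comment> \<open>Compactness of \<open>T\<close> says something about bounded sets only. The
    selection below therefore stays at indices from \<open>N\<close> on, where \<open>C\<close>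
    bounds all elements.\<close>
  obtain C N where CN: "\<And>i f. i \<ge> N \<Longrightarrow> f \<in> F i \<Longrightarrow> vnorm X f \<le> C"
    by (rule X.weakly_null_eventually_bounded[OF wn F]) blast
  define P where "P h \<longleftrightarrow> N \<le> fst h \<and> snd h \<in> F (fst h) \<and> \<epsilon> < vnorm Y (T (snd h))" for h
  have "\<exists>h. \<forall>n. P (h n) \<and> fst (h n) < fst (h (Suc n))"
  proof (rule dependent_nat_choice)
    show "\<exists>h. P h" using large[of N] by (auto simp: P_def)
    show "\<exists>h'. P h' \<and> fst h < fst h'" for h
      using large[of "max N (Suc (fst h))"] by (auto simp: P_def Suc_le_eq)
  qed
  then obtain h where h: "\<And>n. P (h n)" and "\<And>n. fst (h n) < fst (h (Suc n))" by blast
  then have mono: "strict_mono (\<lambda>n. fst (h n))" by (simp add: strict_mono_Suc_iff)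
  define f where "f n = snd (h n)" for n
  have f: "f n \<in> F (fst (h n))" "vnorm X (f n) \<le> C" "\<epsilon> < vnorm Y (T (f n))" for n
    using h[of n] CN by (auto simp: P_def f_def)
  then have f_carrier: "f n \<in> carrier X" for n using F by blast
  then have "range f \<subseteq> carrier X" "\<exists>C. \<forall>x\<in>range f. vnorm X x \<le> C"
    using f(2) by blast+
  with T have "compactin Y.metr.mtopology (Y.metr.mtopology closure_of (T ` range f))"
    unfolding compact_operator_def Y.metr.mtopology_of by blast
  moreover have "range (\<lambda>n. T (f n)) \<subseteq> Y.metr.mtopology closure_of (T ` range f)"
    using closure_of_subset[of "T ` range f" Y.metr.mtopology] closed f_carrier by auto
  ultimately obtain l r where r: "strict_mono r"
    and lim: "limitin Y.metr.mtopology ((\<lambda>n. T (f n)) \<circ> r) l sequentially"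
    unfolding Y.metr.compactin_sequentially by blast
  have l: "l \<in> carrier Y" using lim by (rule Y.metr.limitin_mspace)
  obtain \<psi> where \<psi>: "linear_operator Y scalar_space \<psi>"
    "\<And>y. y \<in> carrier Y \<Longrightarrow> norm (\<psi> y) \<le> vnorm Y y" "norm (\<psi> l) = vnorm Y l"
    by (rule Y.norming_functional[OF l]) blast
  obtain D where D: "\<And>x. x \<in> carrier X \<Longrightarrow> vnorm Y (T x) \<le> D * vnorm X x"
    by (rule compact_operator_bounded[OF X Y T]) blast
  have "(\<lambda>x. \<psi> (T x)) \<in> dual X"
    by (rule dual_comp_bounded_operator[OF X Y lin D \<psi>(1,2)])
  then have "(\<lambda>n. \<psi> (T (f n))) \<longlonglongrightarrow> 0"
    using wn[unfolded weakly_null_def, rule_format, of "\<lambda>x. \<psi> (T x)" "\<lambda>n. fst (h n)" f] mono f(1)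
    by blast
  then have "(\<lambda>n. \<psi> (T (f (r n)))) \<longlonglongrightarrow> 0"
    using LIMSEQ_subseq_LIMSEQ[OF _ r] by (force simp: o_def)
  then have "\<forall>\<^sub>F n in sequentially. norm (\<psi> (T (f (r n)))) < \<epsilon> / 4"
    using \<epsilon> by (auto dest: tendstoD[of _ _ _ "\<epsilon> / 4"])
  moreover have "\<forall>\<^sub>F n in sequentially. norm_dist Y (T (f (r n))) l < \<epsilon> / 4"
    using lim \<epsilon> unfolding Y.metr.limitin_metric
    by (auto dest!: spec[of _ "\<epsilon> / 4"] elim: eventually_mono)
  ultimately obtain n where n: "norm (\<psi> (T (f (r n)))) < \<epsilon> / 4" "norm_dist Y (T (f (r n))) l < \<epsilon> / 4"
    using eventually_happens[OF eventually_conj] by force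
  let ?y = "T (f (r n))"
  have y: "?y \<in> carrier Y" using closed f_carrier by simp
  have "\<psi> (l \<ominus>\<^bsub>Y\<^esub> ?y) = \<psi> l - \<psi> ?y"
    using \<psi>(1) l y Y.scalar_minus_one[OF y, symmetric]
    by (simp add: linear_operator_def scalar_space_def a_minus_def)
  then have "norm (\<psi> l) \<le> norm (\<psi> ?y) + norm_dist Y ?y l"
    using norm_triangle_ineq[of "\<psi> ?y" "\<psi> (l \<ominus>\<^bsub>Y\<^esub> ?y)"] \<psi>(2)[of "l \<ominus>\<^bsub>Y\<^esub> ?y"] l y
    by (simp add: Y.metr.commute[of ?y] Y.norm_dist_eq)
  moreover have "vnorm Y ?y \<le> vnorm Y l + norm_dist Y ?y l"
    using Y.vnorm_le_norm_dist[OF y l] by (simp add: Y.metr.commute)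
  \<comment> \<open>The norm of \<open>l\<close> is below
    \<open>\<epsilon> / 4 + \<epsilon> / 4\<close>, and \<open>T (f (r n))\<close> is within
    \<open>\<epsilon> / 4\<close> of \<open>l\<close>. Its norm is thus below
    \<open>3 * \<epsilon> / 4\<close>, although it exceeds \<open>\<epsilon>\<close>.\<close>
  ultimately show False using n \<psi>(3) f(3)[of "r n"] \<epsilon> by linarith
qed

lemma weakly_null_imp_admissible:
  fixes X :: "('k::{real_normed_field, euclidean_space}, 'a) normed_space"
  assumes "normed_space X" "\<And>i. F i \<subseteq> carrier X" "weakly_null X F"
  shows "admissible TYPE('b) X F"
  unfolding admissible_def
proof (intro allI impI, elim conjE)
  fix Y :: "('k, 'b + 'k) normed_space" and T
  assume "banach_space Y" and T: "compact_operator X Y T"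
  then have Y: "normed_space Y" by (simp add: banach_space_def)
  have "limsup (\<lambda>i. SUP f\<in>F i. ennreal (vnorm Y (T f))) \<le> 0"
  proof (rule ennreal_le_epsilon)
    fix \<epsilon> :: real assume "0 < \<epsilon>"
    with compact_operator_eventually_small[OF assms(1) Y T assms(2,3)]
    have "\<forall>\<^sub>F i in sequentially. \<forall>f\<in>F i. vnorm Y (T f) \<le> \<epsilon>" by blast
    then show "limsup (\<lambda>i. SUP f\<in>F i. ennreal (vnorm Y (T f))) \<le> 0 + ennreal \<epsilon>"
      by (intro Limsup_bounded) (auto elim!: eventually_mono intro!: SUP_least ennreal_leI)
  qed
  then show "limsup (\<lambda>i. SUP f\<in>F i. ennreal (vnorm Y (T f))) = 0" by simp
qed

section \<open>Admissible sequences are weakly null\<close>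

text \<open>Admissibility quantifies over spaces inside \<open>'b + 'k\<close>, so functionals
  become test operators only after the scalar field is placed in the right summand.\<close>

definition scalar_copy :: "('k::real_normed_field, 'b + 'k) normed_space" where
  "scalar_copy = \<lparr>carrier = range Inr, mult = (\<lambda>u v. u), one = Inr 1, zero = Inr 0,
     add = (\<lambda>u v. Inr (projr u + projr v)), smult = (\<lambda>c u. Inr (c * projr u)),
     vnorm = (\<lambda>u. norm (projr u))\<rparr>"

lemma normed_space_scalar_copy: "normed_space (scalar_copy :: ('k::real_normed_field, 'b + 'k) normed_space)"
proof -
  have "cring (scalar_ring :: 'k ring)"
    by (rule cringI)
       (auto simp: scalar_ring_def algebra_simps comm_monoid_def monoid_def comm_monoid_axioms_def
         intro!: abelian_groupI exI[of _ "- x" for x])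
  moreover have "abelian_group (scalar_copy :: ('k, 'b + 'k) normed_space)"
    by (rule abelian_groupI)
      (auto simp: scalar_copy_def algebra_simps, metis add.right_inverse)
  ultimately have "Module.module scalar_ring (scalar_copy :: ('k, 'b + 'k) normed_space)"
    by (rule moduleI) (auto simp: scalar_ring_def scalar_copy_def algebra_simps)
  then show ?thesis
    by (auto simp: normed_space_def scalar_copy_def norm_mult norm_triangle_ineq)
qed

text \<open>\<open>Inr\<close> is an isometry, through which continuity and completeness are
  transferred from the scalars. Negation in the copy is computed as multiplication by the scalar
  -1.\<close>

lemma norm_dist_scalar_copy:
  "norm_dist (scalar_copy :: ('k::{real_normed_field, euclidean_space}, 'b + 'k) normed_space)
     (Inr a) (Inr b) = dist a b"
proof -
  let ?Y = "scalar_copy :: ('k, 'b + 'k) normed_space"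
  interpret carrier_normed_space ?Y
    by unfold_locales (rule normed_space_scalar_copy)
  have "Inr b \<in> carrier ?Y" by (simp add: scalar_copy_def)
  from scalar_minus_one[OF this] have "\<ominus>\<^bsub>?Y\<^esub> (Inr b) = Inr (- b)"
    by (simp add: scalar_copy_def)
  then have "Inr a \<ominus>\<^bsub>?Y\<^esub> Inr b = Inr (a - b)"
    by (simp add: a_minus_def scalar_copy_def)
  then show ?thesis by (simp add: norm_dist_def scalar_copy_def dist_norm)
qed

lemma continuous_map_Inr_scalar_copy:
  "continuous_map euclidean
     (norm_topology (scalar_copy :: ('k::{real_normed_field, euclidean_space}, 'b + 'k) normed_space)) Inr"
proof -
  let ?Y = "scalar_copy :: ('k, 'b + 'k) normed_space"
  interpret carrier_normed_space ?Y
    by unfold_locales (rule normed_space_scalar_copy)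
  have "range Inr = carrier ?Y" by (simp add: scalar_copy_def)
  then have "continuous_map Met_TC.mtopology metr.mtopology (Inr :: 'k \<Rightarrow> 'b + 'k)"
    unfolding Met_TC.metric_continuous_map[OF metr.Metric_space_axioms]
    by (auto simp: norm_dist_scalar_copy)
  then show ?thesis by simp
qed

text \<open>A Cauchy sequence pulls back along the isometry \<open>Inr\<close> to one in the
  complete field \<open>'k\<close>, and the continuous \<open>Inr\<close> carries the limit
  back.\<close>

lemma banach_space_scalar_copy:
  "banach_space (scalar_copy :: ('k::{real_normed_field, euclidean_space}, 'b + 'k) normed_space)"
proof -
  let ?Y = "scalar_copy :: ('k, 'b + 'k) normed_space"
  interpret carrier_normed_space ?Y
    by unfold_locales (rule normed_space_scalar_copy)
  have "metr.mcomplete"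
    unfolding metr.mcomplete_def
  proof (intro allI impI)
    fix \<sigma> assume \<sigma>: "metr.MCauchy \<sigma>"
    then have "range \<sigma> \<subseteq> range Inr"
      unfolding metr.MCauchy_def by (simp add: scalar_copy_def)
    then have "\<forall>n. \<exists>c. \<sigma> n = Inr c" by blast
    then obtain s where s: "\<sigma> = (\<lambda>n. Inr (s n))" by metis
    have "Cauchy s"
      using \<sigma> by (simp add: metr.MCauchy_def s norm_dist_scalar_copy Cauchy_def)
    then obtain c where "s \<longlonglongrightarrow> c"
      by (auto simp: Cauchy_convergent_iff convergent_def)
    then have "limitin metr.mtopology (Inr \<circ> s) (Inr c) sequentially"
      using continuous_map_limit[OF continuous_map_Inr_scalar_copy[where 'k = 'k and 'b = 'b, unfolded metr.mtopology_of]]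
      by simp
    then show "\<exists>x. limitin metr.mtopology \<sigma> x sequentially"
      by (auto simp: s o_def)
  qed
  then show ?thesis
    by (simp add: banach_space_def normed_space_scalar_copy)
qed

text \<open>A bounded functional maps a bounded set into a closed ball of scalars, which is compact
  because \<open>'k\<close> has finite dimension. The closure of the image is a closed subset of the
  copy of that ball.\<close>

lemma compact_operator_scalar_copy:
  fixes X :: "('k::{real_normed_field, euclidean_space}, 'a) normed_space"
  assumes "normed_space X" "\<phi> \<in> dual X"
  shows "compact_operator X (scalar_copy :: ('k, 'b + 'k) normed_space) (\<lambda>x. Inr (\<phi> x))"
    (is "compact_operator X ?Y ?T")
  unfolding compact_operator_def
proof (intro conjI allI impI)
  interpret X: carrier_normed_space X by unfold_locales fact
  interpret Y: carrier_normed_space ?Y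
    by unfold_locales (rule normed_space_scalar_copy)
  obtain C where C: "\<And>x. x \<in> carrier X \<Longrightarrow> norm (\<phi> x) \<le> C * vnorm X x"
    using assms(2) unfolding X.dual_iff_bounded by blast
  show "linear_operator X ?Y ?T"
    using assms(2) by (auto simp: dual_def linear_operator_def scalar_space_def scalar_copy_def)
  fix B assume B: "B \<subseteq> carrier X" and "\<exists>M. \<forall>x\<in>B. vnorm X x \<le> M"
  then obtain M where M: "\<And>x. x \<in> B \<Longrightarrow> vnorm X x \<le> M" by blast
  let ?K = "Inr ` cball (0 :: 'k) (\<bar>C\<bar> * M) :: ('b + 'k) set"
  have K: "compactin (norm_topology ?Y) ?K"
    by (rule image_compactin[OF _ continuous_map_Inr_scalar_copy]) simp
  have "norm (\<phi> x) \<le> \<bar>C\<bar> * M" if "x \<in> B" for x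
  proof -
    have "norm (\<phi> x) \<le> C * vnorm X x" using C B that by blast
    also have "\<dots> \<le> \<bar>C\<bar> * M"
      using M[OF that] X.vnorm_nonneg[of x] B that by (intro mult_mono) auto
    finally show ?thesis .
  qed
  then have sub: "?T ` B \<subseteq> ?K" by auto
  have "closedin (norm_topology ?Y) ?K"
    using K Y.metr.Hausdorff_space_mtopology by (auto intro: compactin_imp_closedin)
  with sub have "norm_topology ?Y closure_of (?T ` B) \<subseteq> ?K"
    by (rule closure_of_minimal)
  then show "compactin (norm_topology ?Y) (norm_topology ?Y closure_of (?T ` B))"
    by (rule closed_compactin[OF K]) simp
qed

text \<open>With the functional itself as test operator, the supremum over \<open>F (i k)\<close>
  dominates \<open>norm (\<phi> (f k))\<close>, and smallness of the suprema passes to the indices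
  \<open>i k\<close>.\<close>

lemma admissible_imp_weakly_null:
  fixes X :: "('k::{real_normed_field, euclidean_space}, 'a) normed_space"
  assumes "normed_space X" and adm: "admissible TYPE('b) X F"
  shows "weakly_null X F"
  unfolding weakly_null_def
proof (intro ballI allI impI, elim conjE)
  fix \<phi> and i :: "nat \<Rightarrow> nat" and f
  assume \<phi>: "\<phi> \<in> dual X" and i: "strict_mono i" and f: "\<forall>k. f k \<in> F (i k)"
  let ?Y = "scalar_copy :: ('k, 'b + 'k) normed_space"
  define S where "S n = (SUP f\<in>F n. ennreal (norm (\<phi> f)))" for n
  have "limsup (\<lambda>n. SUP f\<in>F n. ennreal (vnorm ?Y (Inr (\<phi> f)))) = 0"
    using adm banach_space_scalar_copy compact_operator_scalar_copy[OF assms(1) \<phi>]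
    unfolding admissible_def by blast
  then have "limsup S = 0"
    by (simp add: S_def[abs_def] scalar_copy_def)
  show "(\<lambda>k. \<phi> (f k)) \<longlonglongrightarrow> 0"
  proof (rule tendstoI)
    fix e :: real assume e: "0 < e"
    with \<open>limsup S = 0\<close> have "\<forall>\<^sub>F n in sequentially. S n < ennreal e"
      by (intro Limsup_lessD) simp
    then have "\<forall>\<^sub>F k in sequentially. S (i k) < ennreal e"
      by (rule eventually_subseq[OF i])
    then show "\<forall>\<^sub>F k in sequentially. dist (\<phi> (f k)) 0 < e"
    proof eventually_elim
      case (elim k)
      have "ennreal (norm (\<phi> (f k))) \<le> S (i k)"
        unfolding S_def using f by (intro SUP_upper) simp
      with elim have "ennreal (norm (\<phi> (f k))) < ennreal e" by (rule le_less_trans[rotated])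
      then show ?case using e by (simp add: ennreal_less_iff)
    qed
  qed
qed

theorem theorem2p1:
  fixes X :: "('k::{real_normed_field, euclidean_space}, 'a) normed_space"
    and F :: "nat \<Rightarrow> 'a set"
  assumes "banach_space X"
    and "\<And>i. F i \<subseteq> carrier X"
  shows "admissible TYPE('b) X F \<longleftrightarrow> weakly_null X F"
proof -
  have "normed_space X" using assms(1) by (simp add: banach_space_def)
  then show ?thesis
    using weakly_null_imp_admissible[OF _ assms(2)] admissible_imp_weakly_null by (intro iffI)
qed

end
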